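(* Let $\mathcal G=(G_n,\|\cdot\|_n)_{n\in\mathbb N}$ be a family of metric groups with $\sup\{\|g\|_n : n\in\mathbb N,\ g\in G_n\}<\infty$ (then $\mathcal G^*_{\mathrm{met,fin}}=\mathcal G^*_{\mathrm{met}}$), let $\mathcal U$ be a non-principal ultrafilter on $\mathbb N$, and let $\{X_m\}_{m\in\mathbb N}$ be a countable family of metrically internal subsets of $\mathcal G^*_{\mathrm{met}}$, where $X_m=\frac{\prod_{n\in\mathbb N}X_{m,n}}{\mathcal E}$ with $X_{m,n}\subseteq G_n$. The following conditions are equivalent. (1) $\mathcal G^*_{\mathrm{met}}=\bigcup_{m\in\mathbb N}X_m$. (2) For any countable infinite sequence of positive reals $(\varepsilon_0,\varepsilon_1,\ldots)$ there is $N\in\mathbb N$ such that $$\mathcal G^*_{\mathrm{met}}=X_0\,B_{\varepsilon_0}(e)\cup\ldots\cup X_N\,B_{\varepsilon_N}(e)\quad\text{holds in }\mathcal G^*_{\mathrm{met}},$$ which is equivalent with the clause: for $\mathcal U$-almost all $n\in\mathbb N$, $$G_n=X_{0,n}\,B_{\varepsilon_0}(e)\cup\ldots\cup X_{N,n}\,B_{\varepsilon_N}(e)\quad\text{holds in }G_n.$$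
   Context: A metric group $(G,\|\cdot\|)$ is a group with a bi-invariant norm $\|\cdot\|\colon G\to[0,\infty]$: $\|e\|=0$, $\|gh\|\le\|g\|+\|h\|$, $\|g^{-1}\|=\|g\|=\|hgh^{-1}\|$, and $\|g\|=0$ iff $g=e$. $B_\varepsilon(e)=\{h : \|h\|<\varepsilon\}$, computed in the group indicated. The metric ultraproduct is $\mathcal G^*_{\mathrm{met}}=\prod_{n}G_n/\mathcal E$, where $\mathcal E=\{(g_n)\in\prod_n G_n : \lim_{n\to\mathcal U}\|g_n\|_n=0\}$ is the subgroup of infinitesimals, with norm $\|(g_n)/\mathcal E\|=\lim_{n\to\mathcal U}\|g_n\|_n$. Its finitary subgroup is $\mathcal G^*_{\mathrm{met,fin}}=\{x\in\mathcal G^*_{\mathrm{met}} : \|x\|<\infty\}$. For $Y_n\subseteq G_n$, $\frac{\prod_n Y_n}{\mathcal E}$ denotes the image of $\prod_nY_n$ in $\mathcal G^*_{\mathrm{met}}$; a subset of $\mathcal G^*_{\mathrm{met}}$ is metrically internal if it is of this form. "For $\mathcal U$-almost all $n$" means for a set of $n$ belonging to $\mathcal U$. Products of subsets are elementwise products.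
   Formalization: The clause for almost all n is compared with (2) after quantifying over all sequences ε (for one fixed ε it is not equivalent), and its implication to (2) assumes that, for each m, if some X_{m,n} is empty then U-almost all are. *)

theory Defs
  imports "HOL-Algebra.Coset" "HOL-Algebra.Product_Groups"
    "HOL-Library.Extended_Nonnegative_Real"
begin

locale metric_group = group G for G (structure) +
  fixes nrm :: "'a \<Rightarrow> ennreal"
  assumes norm_one: "nrm \<one> = 0"
    and norm_mult_le: "\<lbrakk>g \<in> carrier G; h \<in> carrier G\<rbrakk> \<Longrightarrow> nrm (g \<otimes> h) \<le> nrm g + nrm h"
    and norm_inv: "g \<in> carrier G \<Longrightarrow> nrm (inv g) = nrm g"
    and norm_conj: "\<lbrakk>g \<in> carrier G; h \<in> carrier G\<rbrakk> \<Longrightarrow> nrm (h \<otimes> g \<otimes> inv h) = nrm g"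
    and norm_eq_0_iff: "g \<in> carrier G \<Longrightarrow> nrm g = 0 \<longleftrightarrow> g = \<one>"

definition ball_one :: "('a, 'b) monoid_scheme \<Rightarrow> ('a \<Rightarrow> ennreal) \<Rightarrow> real \<Rightarrow> 'a set"
  where "ball_one G nrm \<epsilon> = {h \<in> carrier G. nrm h < ennreal \<epsilon>}"

text \<open>Filters stand for families of subsets: \<open>A\<close> belongs to \<open>U\<close> iff \<open>\<forall>\<^sub>F n in U. n \<in> A\<close>.\<close>

definition nonprincipal_ultrafilter :: "'i filter \<Rightarrow> bool"
  where "nonprincipal_ultrafilter U \<longleftrightarrow>
    U \<noteq> bot \<and>
    (\<forall>P. (\<forall>\<^sub>F n in U. P n) \<or> (\<forall>\<^sub>F n in U. \<not> P n)) \<and>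
    (\<forall>k. U \<noteq> principal {k})"

definition infinitesimals ::
    "nat filter \<Rightarrow> (nat \<Rightarrow> ('a, 'b) monoid_scheme) \<Rightarrow> (nat \<Rightarrow> 'a \<Rightarrow> ennreal) \<Rightarrow> (nat \<Rightarrow> 'a) set"
  where "infinitesimals U G nrm =
    {g \<in> carrier (product_group UNIV G). ((\<lambda>n. nrm n (g n)) \<longlongrightarrow> 0) U}"

definition metric_ultraproduct ::
    "nat filter \<Rightarrow> (nat \<Rightarrow> ('a, 'b) monoid_scheme) \<Rightarrow> (nat \<Rightarrow> 'a \<Rightarrow> ennreal) \<Rightarrow> (nat \<Rightarrow> 'a) set monoid"
  where "metric_ultraproduct U G nrm = product_group UNIV G Mod infinitesimals U G nrm"

text \<open>The limit does not depend on the representative of the coset \<open>x\<close>, because members of one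
  coset differ by an infinitesimal.\<close>

definition ultraproduct_norm ::
    "nat filter \<Rightarrow> (nat \<Rightarrow> 'a \<Rightarrow> ennreal) \<Rightarrow> (nat \<Rightarrow> 'a) set \<Rightarrow> ennreal"
  where "ultraproduct_norm U nrm x = Lim U (\<lambda>n. nrm n ((SOME g. g \<in> x) n))"

definition finitary_part ::
    "nat filter \<Rightarrow> (nat \<Rightarrow> ('a, 'b) monoid_scheme) \<Rightarrow> (nat \<Rightarrow> 'a \<Rightarrow> ennreal) \<Rightarrow> (nat \<Rightarrow> 'a) set set"
  where "finitary_part U G nrm =
    {x \<in> carrier (metric_ultraproduct U G nrm). ultraproduct_norm U nrm x < \<infinity>}"

text \<open>The image in the metric ultraproduct of the full product of the sets \<open>Y n\<close>. It is empty as
  soon as a single \<open>Y n\<close> is empty.\<close>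

definition internal_set ::
    "nat filter \<Rightarrow> (nat \<Rightarrow> ('a, 'b) monoid_scheme) \<Rightarrow> (nat \<Rightarrow> 'a \<Rightarrow> ennreal) \<Rightarrow> (nat \<Rightarrow> 'a set)
      \<Rightarrow> (nat \<Rightarrow> 'a) set set"
  where "internal_set U G nrm Y =
    (\<lambda>g. infinitesimals U G nrm #>\<^bsub>product_group UNIV G\<^esub> g) ` (\<Pi>\<^sub>E n\<in>UNIV. Y n)"

end

theory Submission
  imports Defs
begin

text \<open>Everything rests on countable saturation: if each condition \<open>Q k\<close> holds \<open>U\<close>-almost everywhere,
  then a single index function \<open>K\<close> tending to infinity satisfies \<open>Q (K n) n\<close> for \<open>U\<close>-almost all \<open>n\<close>.
  If no finite union \<open>X\<^sub>0 B(\<epsilon>\<^sub>0) \<union> \<dots> \<union> X\<^sub>N B(\<epsilon>\<^sub>N)\<close> covers the ultraproduct, choose \<open>h\<^sub>N\<close> outside it; then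
  the components of \<open>h\<^sub>N\<close> stay at distance at least \<open>\<epsilon>\<^sub>m / 2\<close> from \<open>X\<^sub>m\<close> for all \<open>m \<le> N\<close>, and the diagonal
  element with components \<open>h\<close> at \<open>K n\<close> lies outside every \<open>X\<^sub>m\<close>. Conversely, saturation shows that internal
  sets are closed, so a point outside all \<open>X\<^sub>m\<close> has positive distance \<open>\<epsilon>\<^sub>m\<close> to each of them, and this sequence
  violates the finite covering condition. The componentwise clause follows because a finite
  disjunction that holds \<open>U\<close>-almost everywhere has a disjunct that does; the radii are halved because
  strict inequalities weaken in the limit.\<close>

section \<open>Distances in a single metric group\<close>

lemma (in metric_group) norm_commute:
  assumes "g \<in> carrier G" "h \<in> carrier G"
  shows "nrm (g \<otimes> h) = nrm (h \<otimes> g)"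
proof -
  have "nrm (h \<otimes> (g \<otimes> h) \<otimes> inv h) = nrm (g \<otimes> h)"
    using assms by (intro norm_conj) auto
  moreover have "h \<otimes> (g \<otimes> h) \<otimes> inv h = h \<otimes> g"
    using assms by (simp add: m_assoc)
  ultimately show ?thesis by simp
qed

text \<open>Once the factor \<open>x\<close> from \<open>Y\<close> is fixed, the ball factor can
  only be \<open>inv x \<otimes> g\<close>. Product sets thereby become statements about distances
  to points of \<open>Y\<close>.\<close>

lemma (in metric_group) mem_set_mult_ball_one_iff:
  assumes "Y \<subseteq> carrier G" "g \<in> carrier G"
  shows "g \<in> Y <#> ball_one G nrm \<epsilon> \<longleftrightarrow> (\<exists>x\<in>Y. nrm (inv x \<otimes> g) < ennreal \<epsilon>)"
proof
  assume "g \<in> Y <#> ball_one G nrm \<epsilon>"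
  then obtain x b where x: "x \<in> Y" and b: "b \<in> carrier G" "nrm b < ennreal \<epsilon>" and "g = x \<otimes> b"
    by (auto simp: set_mult_def ball_one_def)
  then have "inv x \<otimes> g = b"
    using assms by (metis inv_solve_left subsetD m_closed)
  then show "\<exists>x\<in>Y. nrm (inv x \<otimes> g) < ennreal \<epsilon>"
    using x b by auto
next
  assume "\<exists>x\<in>Y. nrm (inv x \<otimes> g) < ennreal \<epsilon>"
  then obtain x where x: "x \<in> Y" "nrm (inv x \<otimes> g) < ennreal \<epsilon>" by blast
  moreover have "g = x \<otimes> (inv x \<otimes> g)"
    using assms x by (metis inv_closed l_one m_assoc r_inv subsetD)
  moreover have "inv x \<otimes> g \<in> carrier G" using assms x by auto
  ultimately show "g \<in> Y <#> ball_one G nrm \<epsilon>"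
    unfolding set_mult_def ball_one_def by blast
qed

section \<open>Ultrafilters and limits along them\<close>

locale metric_group_sequence =
  fixes G :: "nat \<Rightarrow> ('a, 'b) monoid_scheme"
    and nrm :: "nat \<Rightarrow> 'a \<Rightarrow> ennreal"
    and U :: "nat filter"
  assumes metric_groups: "\<And>n. metric_group (G n) (nrm n)"
    and nonprincipal: "nonprincipal_ultrafilter U"
begin

sublocale comp: metric_group "G n" "nrm n" for n
  by (rule metric_groups)

abbreviation "P \<equiv> product_group UNIV G"
abbreviation "E \<equiv> infinitesimals U G nrm"
abbreviation "Gmet \<equiv> metric_ultraproduct U G nrm"
abbreviation cls :: "(nat \<Rightarrow> 'a) \<Rightarrow> (nat \<Rightarrow> 'a) set"
  where "cls g \<equiv> E #>\<^bsub>P\<^esub> g"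

sublocale P: group P
  by (rule product_group) (rule comp.is_group)

lemma U_nontrivial: "U \<noteq> bot"
  using nonprincipal by (simp add: nonprincipal_ultrafilter_def)

text \<open>Maximality of the ultrafilter gives one direction and properness the other. This turns
  the failure of a property into information that holds almost everywhere.\<close>

lemma not_eventually_iff: "\<not> (\<forall>\<^sub>F n in U. Q n) \<longleftrightarrow> (\<forall>\<^sub>F n in U. \<not> Q n)"
proof
  show "\<not> (\<forall>\<^sub>F n in U. Q n) \<Longrightarrow> \<forall>\<^sub>F n in U. \<not> Q n"
    using nonprincipal unfolding nonprincipal_ultrafilter_def by blast
  show "\<forall>\<^sub>F n in U. \<not> Q n \<Longrightarrow> \<not> (\<forall>\<^sub>F n in U. Q n)"
    using U_nontrivial eventually_elim2[of "\<lambda>n. \<not> Q n" U Q "\<lambda>_. False"] by (auto simp: trivial_limit_def)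
qed

text \<open>A nonprincipal ultrafilter contains no singleton, so the complement of every finite set
  is large.\<close>

lemma eventually_ge: "\<forall>\<^sub>F n in U. k \<le> n"
proof -
  have ne: "\<forall>\<^sub>F n in U. n \<noteq> j" for j
  proof (rule ccontr)
    assume "\<not> (\<forall>\<^sub>F n in U. n \<noteq> j)"
    then have j: "\<forall>\<^sub>F n in U. n = j"
      by (simp add: not_eventually_iff)
    \<comment> \<open>If the singleton of \<open>j\<close> were large, \<open>U\<close> would
      contain exactly the sets that have \<open>j\<close> as a member.\<close>
    have "(\<forall>\<^sub>F n in U. Q n) \<longleftrightarrow> Q j" for Q
    proof
      assume "\<forall>\<^sub>F n in U. Q n"
      with j have "\<forall>\<^sub>F n in U. Q j" by eventually_elim simp
      then show "Q j" using U_nontrivial eventually_const by blast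
    next
      show "\<forall>\<^sub>F n in U. Q n" if "Q j" using j by eventually_elim (simp add: that)
    qed
    then have "U = principal {j}"
      by (simp add: filter_eq_iff eventually_principal)
    then show False using nonprincipal by (auto simp: nonprincipal_ultrafilter_def)
  qed
  have "\<forall>\<^sub>F n in U. \<forall>j\<in>{..<k}. n \<noteq> j"
    by (intro eventually_ball_finite) (auto intro: ne)
  then show ?thesis by eventually_elim (metis lessThan_iff not_less)
qed

text \<open>The index \<open>K n\<close> is the largest \<open>j \<le> n\<close> for which
  \<open>Q j n\<close> holds; the bound by \<open>n\<close> keeps the candidates finite in number.
  For \<open>n \<ge> k\<close> with \<open>Q k n\<close>, the number \<open>k\<close> is itself a
  candidate, which gives both claims at once.\<close>

lemma diagonal_index:
  assumes "\<And>k. \<forall>\<^sub>F n in U. Q k n"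
  obtains K :: "nat \<Rightarrow> nat" where "\<And>k. \<forall>\<^sub>F n in U. k \<le> K n \<and> Q (K n) n"
proof
  fix k
  show "\<forall>\<^sub>F n in U. k \<le> Max {j. j \<le> n \<and> Q j n} \<and> Q (Max {j. j \<le> n \<and> Q j n}) n"
    using assms[of k] eventually_ge[of k]
  proof eventually_elim
    case (elim n)
    have "k \<in> {j. j \<le> n \<and> Q j n}" using elim by simp
    then have "k \<le> Max {j. j \<le> n \<and> Q j n}"
      by (intro Max_ge) simp_all
    moreover have "Max {j. j \<le> n \<and> Q j n} \<in> {j. j \<le> n \<and> Q j n}"
      using \<open>k \<in> _\<close> by (intro Max_in) auto
    ultimately show ?case by simp
  qed
qed

text \<open>Along an ultrafilter the limes inferior is already the limit: if \<open>f n < a\<close>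
  fails to hold almost everywhere, then \<open>a \<le> f n\<close> holds almost everywhere, and
  \<open>a\<close> is a lower bound for the limes inferior.\<close>

lemma tendsto_Lim_ennreal:
  fixes f :: "nat \<Rightarrow> ennreal"
  shows "(f \<longlongrightarrow> Lim U f) U"
proof -
  have "(f \<longlongrightarrow> Liminf U f) U"
  proof (rule order_tendstoI)
    show "\<forall>\<^sub>F n in U. a < f n" if "a < Liminf U f" for a
      using that by (rule less_LiminfD)
    show "\<forall>\<^sub>F n in U. f n < a" if "Liminf U f < a" for a
    proof (rule ccontr)
      assume "\<not> ?thesis"
      then have "\<forall>\<^sub>F n in U. a \<le> f n"
        by (simp add: not_eventually_iff not_less)
      then have "a \<le> Liminf U f" by (rule Liminf_bounded)
      then show False using that by simp
    qed
  qed
  then show ?thesis using U_nontrivial by (metis tendsto_Lim)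
qed

lemma Lim_le:
  fixes f :: "nat \<Rightarrow> ennreal"
  assumes "\<forall>\<^sub>F n in U. f n \<le> c"
  shows "Lim U f \<le> c"
  using tendsto_Lim_ennreal assms U_nontrivial by (rule tendsto_upperbound)

lemma eventually_less_if_Lim_less:
  fixes f :: "nat \<Rightarrow> ennreal"
  assumes "Lim U f < c"
  shows "\<forall>\<^sub>F n in U. f n < c"
  using order_tendstoD(2)[OF tendsto_Lim_ennreal assms] .

lemma quotient_closed:
  assumes "x \<in> carrier P" "g \<in> carrier P"
  shows "(\<lambda>n. inv\<^bsub>G n\<^esub> x n \<otimes>\<^bsub>G n\<^esub> g n) \<in> carrier P"
  using assms by (auto simp: PiE_iff)

lemma infinitesimals_normal: "E \<lhd> P"
proof (rule P.normal_invI)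
  show "subgroup E P"
  proof
    show "E \<subseteq> carrier P" by (auto simp: infinitesimals_def)
    show "\<one>\<^bsub>P\<^esub> \<in> E" by (simp add: infinitesimals_def comp.norm_one)
    show "inv\<^bsub>P\<^esub> x \<in> E" if "x \<in> E" for x
      using that by (simp add: infinitesimals_def PiE_iff comp.norm_inv comp.is_group)
    show "x \<otimes>\<^bsub>P\<^esub> y \<in> E" if x: "x \<in> E" and y: "y \<in> E" for x y
    proof -
      have "((\<lambda>n. nrm n (x n) + nrm n (y n)) \<longlongrightarrow> 0 + 0) U"
        using x y by (intro tendsto_add) (auto simp: infinitesimals_def)
      then have lim: "((\<lambda>n. nrm n (x n) + nrm n (y n)) \<longlongrightarrow> 0) U"
        by simp
      have "nrm n (x n \<otimes>\<^bsub>G n\<^esub> y n) \<le> nrm n (x n) + nrm n (y n)" for n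
        using x y by (intro comp.norm_mult_le) (auto simp: infinitesimals_def)
      then have "((\<lambda>n. nrm n (x n \<otimes>\<^bsub>G n\<^esub> y n)) \<longlongrightarrow> 0) U"
        by (intro tendsto_sandwich[OF _ _ tendsto_const lim]) simp_all
      then show ?thesis
        using x y by (auto simp: infinitesimals_def PiE_iff)
    qed
  qed
  show "x \<otimes>\<^bsub>P\<^esub> h \<otimes>\<^bsub>P\<^esub> inv\<^bsub>P\<^esub> x \<in> E" if "x \<in> carrier P" "h \<in> E" for x h
    using that by (auto simp: infinitesimals_def PiE_iff comp.norm_conj comp.is_group)
qed

sublocale E: normal E P
  by (rule infinitesimals_normal)

lemma carrier_metric_ultraproduct: "carrier Gmet = cls ` carrier P"
  by (simp only: metric_ultraproduct_def carrier_FactGroup)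

lemma mult_cls:
  assumes "x \<in> carrier P" "y \<in> carrier P"
  shows "cls x \<otimes>\<^bsub>Gmet\<^esub> cls y = cls (x \<otimes>\<^bsub>P\<^esub> y)"
  using assms unfolding metric_ultraproduct_def mult_FactGroup by (rule E.rcos_sum)

lemma cls_eq_iff:
  assumes x: "x \<in> carrier P" and g: "g \<in> carrier P"
  shows "cls x = cls g \<longleftrightarrow> ((\<lambda>n. nrm n (inv\<^bsub>G n\<^esub> x n \<otimes>\<^bsub>G n\<^esub> g n)) \<longlongrightarrow> 0) U"
proof -
  have "cls x = cls g \<longleftrightarrow> g \<in> cls x"
    using P.repr_independence[OF _ x E.is_subgroup] P.rcos_self[OF g E.is_subgroup] by auto
  also have "\<dots> \<longleftrightarrow> g \<otimes>\<^bsub>P\<^esub> inv\<^bsub>P\<^esub> x \<in> E"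
    using E.rcos_module[OF P.is_group x g] .
  also have "\<dots> \<longleftrightarrow> ((\<lambda>n. nrm n (g n \<otimes>\<^bsub>G n\<^esub> inv\<^bsub>G n\<^esub> x n)) \<longlongrightarrow> 0) U"
    using x g by (auto simp: infinitesimals_def PiE_iff comp.is_group)
  \<comment> \<open>Right cosets produce the quotient with the inverse on the right. Invariance of
    the norm under cyclic exchange moves it to the left, the form used in all distance
    estimates.\<close>
  also have "(\<lambda>n. nrm n (g n \<otimes>\<^bsub>G n\<^esub> inv\<^bsub>G n\<^esub> x n)) = (\<lambda>n. nrm n (inv\<^bsub>G n\<^esub> x n \<otimes>\<^bsub>G n\<^esub> g n))"
    using x g by (intro ext comp.norm_commute) auto
  finally show ?thesis .
qed

text \<open>The norm is computed from a chosen representative \<open>h\<close>. It differs from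
  \<open>g\<close> by an infinitesimal left factor \<open>e\<close>, so the triangle inequality in
  both directions forces equal limits.\<close>

lemma ultraproduct_norm_cls:
  assumes g: "g \<in> carrier P"
  shows "ultraproduct_norm U nrm (cls g) = Lim U (\<lambda>n. nrm n (g n))"
proof -
  define h where "h = (SOME h. h \<in> cls g)"
  have h: "h \<in> cls g"
    using P.rcos_self[OF g E.is_subgroup] unfolding h_def by (rule someI[of "\<lambda>h. h \<in> cls g"])
  then obtain e where e: "e \<in> E" and he: "h = e \<otimes>\<^bsub>P\<^esub> g"
    by (auto simp: r_coset_def)
  have eP: "e \<in> carrier P" and e0: "((\<lambda>n. nrm n (e n)) \<longlongrightarrow> 0) U"
    using e by (auto simp: infinitesimals_def)
  have hP: "h \<in> carrier P" using he eP g P.m_closed by metis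
  \<comment> \<open>Used twice: for \<open>h\<close> as the product of \<open>e\<close> and
    \<open>g\<close>, and for \<open>g\<close> as the product of the inverse of \<open>e\<close> and
    \<open>h\<close>.\<close>
  have le: "Lim U (\<lambda>n. nrm n (a n)) \<le> Lim U (\<lambda>n. nrm n (b n))"
    if "\<And>n. nrm n (a n) \<le> nrm n (e n) + nrm n (b n)" for a b
  proof (rule tendsto_le[OF U_nontrivial _ tendsto_Lim_ennreal])
    show "((\<lambda>n. nrm n (e n) + nrm n (b n)) \<longlongrightarrow> Lim U (\<lambda>n. nrm n (b n))) U"
      using tendsto_add[OF e0 tendsto_Lim_ennreal] by simp
  qed (simp add: that)
  have 1: "nrm n (h n) \<le> nrm n (e n) + nrm n (g n)" for n
    using eP g by (auto simp: he PiE_iff intro: comp.norm_mult_le)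
  have 2: "nrm n (g n) \<le> nrm n (e n) + nrm n (h n)" for n
  proof -
    have c: "e n \<in> carrier (G n)" "g n \<in> carrier (G n)" "h n \<in> carrier (G n)"
      using eP g hP by auto
    have "g n = inv\<^bsub>G n\<^esub> e n \<otimes>\<^bsub>G n\<^esub> h n"
      using c by (simp add: he comp.inv_solve_left)
    then show ?thesis
      using comp.norm_mult_le[of "inv\<^bsub>G n\<^esub> e n" n "h n"] c by (simp add: comp.norm_inv)
  qed
  show ?thesis
    unfolding ultraproduct_norm_def h_def[symmetric] using le[OF 1] le[OF 2] by (rule antisym)
qed

section \<open>Internal sets and their neighbourhoods\<close>

lemma cls_mem_internal_set_iff:
  assumes "\<And>n. Y n \<subseteq> carrier (G n)" "g \<in> carrier P"
  shows "cls g \<in> internal_set U G nrm Y \<longleftrightarrow>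
    (\<exists>x\<in>\<Pi>\<^sub>E n\<in>UNIV. Y n. ((\<lambda>n. nrm n (inv\<^bsub>G n\<^esub> x n \<otimes>\<^bsub>G n\<^esub> g n)) \<longlongrightarrow> 0) U)"
proof -
  have "cls g \<in> internal_set U G nrm Y \<longleftrightarrow> (\<exists>x\<in>\<Pi>\<^sub>E n\<in>UNIV. Y n. cls x = cls g)"
    unfolding internal_set_def image_iff by (simp only: eq_commute)
  also have "\<dots> \<longleftrightarrow> (\<exists>x\<in>\<Pi>\<^sub>E n\<in>UNIV. Y n. ((\<lambda>n. nrm n (inv\<^bsub>G n\<^esub> x n \<otimes>\<^bsub>G n\<^esub> g n)) \<longlongrightarrow> 0) U)"
  proof (intro bex_cong refl cls_eq_iff assms(2))
    fix x assume "x \<in> (\<Pi>\<^sub>E n\<in>UNIV. Y n)"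
    then show "x \<in> carrier P" using assms(1) by (auto simp: PiE_iff)
  qed
  finally show ?thesis .
qed

text \<open>As in a single group, the ball factor is determined by the other one: it is the class of
  the componentwise quotient, whose norm is the limit of the component norms.\<close>

lemma cls_mem_set_mult_ball_iff:
  assumes Y: "\<And>n. Y n \<subseteq> carrier (G n)" and g: "g \<in> carrier P"
  shows "cls g \<in> internal_set U G nrm Y <#>\<^bsub>Gmet\<^esub> ball_one Gmet (ultraproduct_norm U nrm) \<epsilon> \<longleftrightarrow>
    (\<exists>x\<in>\<Pi>\<^sub>E n\<in>UNIV. Y n. Lim U (\<lambda>n. nrm n (inv\<^bsub>G n\<^esub> x n \<otimes>\<^bsub>G n\<^esub> g n)) < ennreal \<epsilon>)"
proof
  have YP: "x \<in> carrier P" if "x \<in> (\<Pi>\<^sub>E n\<in>UNIV. Y n)" for x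
    using that Y by (auto simp: PiE_iff)
  have quot: "inv\<^bsub>P\<^esub> x \<otimes>\<^bsub>P\<^esub> g = (\<lambda>n. inv\<^bsub>G n\<^esub> x n \<otimes>\<^bsub>G n\<^esub> g n)" if "x \<in> carrier P" for x
    using that by (simp add: comp.is_group restrict_UNIV)
  {
    assume "cls g \<in> internal_set U G nrm Y <#>\<^bsub>Gmet\<^esub> ball_one Gmet (ultraproduct_norm U nrm) \<epsilon>"
    then obtain x b where x: "x \<in> (\<Pi>\<^sub>E n\<in>UNIV. Y n)" and b: "b \<in> carrier P"
      and lt: "ultraproduct_norm U nrm (cls b) < ennreal \<epsilon>"
      and eq: "cls g = cls x \<otimes>\<^bsub>Gmet\<^esub> cls b"
      by (auto simp: set_mult_def internal_set_def ball_one_def carrier_metric_ultraproduct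
          simp del: carrier_product_group mult_product_group)
    note xP = YP[OF x]
    \<comment> \<open>Multiplying \<open>eq\<close> on the left by the class of the inverse of
      \<open>x\<close> identifies the class of the quotient with that of \<open>b\<close>.\<close>
    have "cls (inv\<^bsub>P\<^esub> x \<otimes>\<^bsub>P\<^esub> g) = cls (inv\<^bsub>P\<^esub> x) \<otimes>\<^bsub>Gmet\<^esub> cls (x \<otimes>\<^bsub>P\<^esub> b)"
      using xP b g by (simp only: mult_cls[symmetric] P.inv_closed eq)
    also have "\<dots> = cls (inv\<^bsub>P\<^esub> x \<otimes>\<^bsub>P\<^esub> (x \<otimes>\<^bsub>P\<^esub> b))"
      using xP b by (intro mult_cls P.inv_closed P.m_closed)
    also have "inv\<^bsub>P\<^esub> x \<otimes>\<^bsub>P\<^esub> (x \<otimes>\<^bsub>P\<^esub> b) = b"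
      using xP b by (metis P.inv_solve_left P.m_closed)
    finally have "ultraproduct_norm U nrm (cls (inv\<^bsub>P\<^esub> x \<otimes>\<^bsub>P\<^esub> g)) < ennreal \<epsilon>"
      using lt by (simp only:)
    then show "\<exists>x\<in>\<Pi>\<^sub>E n\<in>UNIV. Y n. Lim U (\<lambda>n. nrm n (inv\<^bsub>G n\<^esub> x n \<otimes>\<^bsub>G n\<^esub> g n)) < ennreal \<epsilon>"
      unfolding quot[OF xP] ultraproduct_norm_cls[OF quotient_closed[OF xP g]] using x by blast
  next
    assume "\<exists>x\<in>\<Pi>\<^sub>E n\<in>UNIV. Y n. Lim U (\<lambda>n. nrm n (inv\<^bsub>G n\<^esub> x n \<otimes>\<^bsub>G n\<^esub> g n)) < ennreal \<epsilon>"
    then obtain x where x: "x \<in> (\<Pi>\<^sub>E n\<in>UNIV. Y n)"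
      and lt: "Lim U (\<lambda>n. nrm n (inv\<^bsub>G n\<^esub> x n \<otimes>\<^bsub>G n\<^esub> g n)) < ennreal \<epsilon>" by blast
    note xP = YP[OF x]
    define b where "b = (\<lambda>n. inv\<^bsub>G n\<^esub> x n \<otimes>\<^bsub>G n\<^esub> g n)"
    have bP: "b \<in> carrier P" unfolding b_def by (rule quotient_closed[OF xP g])
    have "x \<otimes>\<^bsub>P\<^esub> b = g"
      unfolding b_def quot[OF xP, symmetric] using xP g by (metis P.inv_closed P.l_one P.m_assoc P.r_inv)
    then have "cls g = cls x \<otimes>\<^bsub>Gmet\<^esub> cls b"
      using mult_cls[OF xP bP] by simp
    moreover have "cls x \<in> internal_set U G nrm Y"
      unfolding internal_set_def using x by blast
    moreover have "ultraproduct_norm U nrm (cls b) < ennreal \<epsilon>"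
      using lt unfolding ultraproduct_norm_cls[OF bP] unfolding b_def .
    then have "cls b \<in> ball_one Gmet (ultraproduct_norm U nrm) \<epsilon>"
      using bP unfolding ball_one_def carrier_metric_ultraproduct by blast
    ultimately show "cls g \<in> internal_set U G nrm Y <#>\<^bsub>Gmet\<^esub> ball_one Gmet (ultraproduct_norm U nrm) \<epsilon>"
      unfolding set_mult_def by blast
  }
qed

lemma internal_set_subset_carrier:
  assumes "\<And>n. Y n \<subseteq> carrier (G n)"
  shows "internal_set U G nrm Y \<subseteq> carrier Gmet"
  unfolding internal_set_def carrier_metric_ultraproduct
  using assms by (intro image_mono) (simp add: PiE_mono)

lemma carrier_metric_ultraproduct_eq_Union_iff:
  assumes "\<And>m. m \<in> I \<Longrightarrow> S m \<subseteq> carrier Gmet"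
  shows "carrier Gmet = (\<Union>m\<in>I. S m) \<longleftrightarrow> (\<forall>g\<in>carrier P. \<exists>m\<in>I. cls g \<in> S m)"
proof -
  have "carrier Gmet = (\<Union>m\<in>I. S m) \<longleftrightarrow> carrier Gmet \<subseteq> (\<Union>m\<in>I. S m)"
    using assms by blast
  then show ?thesis
    unfolding carrier_metric_ultraproduct by blast
qed

lemma set_mult_ball_subset_carrier:
  assumes "\<And>n. Y n \<subseteq> carrier (G n)"
  shows "internal_set U G nrm Y <#>\<^bsub>Gmet\<^esub> ball_one Gmet (ultraproduct_norm U nrm) \<epsilon> \<subseteq> carrier Gmet"
proof (rule group.setmult_subset_G)
  show "Group.group Gmet"
    unfolding metric_ultraproduct_def by (rule E.factorgroup_is_group)
qed (use internal_set_subset_carrier assms in \<open>auto simp: ball_one_def\<close>)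

text \<open>Otherwise almost every component has a point of \<open>Y n\<close> within \<delta> of
  \<open>g n\<close>, and these points assemble into a representative. Their distances have a limit
  of at most \<delta>, and the gap below \<epsilon> restores the strict inequality of the
  ball.\<close>

lemma cls_notin_set_mult_ball:
  assumes Y: "\<And>n. Y n \<subseteq> carrier (G n)" "\<And>n. Y n \<noteq> {}" and g: "g \<in> carrier P"
    and notin: "cls g \<notin> internal_set U G nrm Y <#>\<^bsub>Gmet\<^esub> ball_one Gmet (ultraproduct_norm U nrm) \<epsilon>"
    and "0 < \<epsilon>" "\<delta> < \<epsilon>"
  shows "\<forall>\<^sub>F n in U. \<forall>x\<in>Y n. ennreal \<delta> < nrm n (inv\<^bsub>G n\<^esub> x \<otimes>\<^bsub>G n\<^esub> g n)"
proof (rule ccontr)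
  assume "\<not> ?thesis"
  then have ev: "\<forall>\<^sub>F n in U. \<exists>x\<in>Y n. nrm n (inv\<^bsub>G n\<^esub> x \<otimes>\<^bsub>G n\<^esub> g n) \<le> ennreal \<delta>"
    by (simp add: not_eventually_iff not_less)
  \<comment> \<open>At indices without a near point, any element of \<open>Y n\<close> serves. A
    value is required at every index because \<open>internal_set\<close> is the image of the full
    product.\<close>
  have "\<exists>y. y \<in> Y n \<and> ((\<exists>x\<in>Y n. nrm n (inv\<^bsub>G n\<^esub> x \<otimes>\<^bsub>G n\<^esub> g n) \<le> ennreal \<delta>) \<longrightarrow>
      nrm n (inv\<^bsub>G n\<^esub> y \<otimes>\<^bsub>G n\<^esub> g n) \<le> ennreal \<delta>)" for n
    using Y(2)[of n] by auto
  then obtain x where x: "\<And>n. x n \<in> Y n"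
    and le: "\<And>n. \<exists>x\<in>Y n. nrm n (inv\<^bsub>G n\<^esub> x \<otimes>\<^bsub>G n\<^esub> g n) \<le> ennreal \<delta> \<Longrightarrow>
      nrm n (inv\<^bsub>G n\<^esub> x n \<otimes>\<^bsub>G n\<^esub> g n) \<le> ennreal \<delta>"
    by metis
  have "Lim U (\<lambda>n. nrm n (inv\<^bsub>G n\<^esub> x n \<otimes>\<^bsub>G n\<^esub> g n)) \<le> ennreal \<delta>"
    using ev by (intro Lim_le) (auto elim!: eventually_mono intro: le)
  also have "\<dots> < ennreal \<epsilon>" using \<open>0 < \<epsilon>\<close> \<open>\<delta> < \<epsilon>\<close> by (rule ennreal_lessI)
  finally show False
    using notin cls_mem_set_mult_ball_iff[OF Y(1) g] x by (auto simp: PiE_iff)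
qed

text \<open>Representatives \<open>x k\<close> at distance below \<open>1 / (k + 1)\<close> are
  merged along the diagonal index \<open>K\<close> into one representative at infinitesimal
  distance.\<close>

lemma internal_set_closed:
  assumes Y: "\<And>n. Y n \<subseteq> carrier (G n)" and g: "g \<in> carrier P"
    and close: "\<And>\<epsilon>. 0 < \<epsilon> \<Longrightarrow>
      cls g \<in> internal_set U G nrm Y <#>\<^bsub>Gmet\<^esub> ball_one Gmet (ultraproduct_norm U nrm) \<epsilon>"
  shows "cls g \<in> internal_set U G nrm Y"
proof -
  have "\<forall>k. \<exists>x. x \<in> (\<Pi>\<^sub>E n\<in>UNIV. Y n) \<and>
      (\<forall>\<^sub>F n in U. nrm n (inv\<^bsub>G n\<^esub> x n \<otimes>\<^bsub>G n\<^esub> g n) < ennreal (1 / real (Suc k)))"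
  proof
    fix k
    have "0 < 1 / real (Suc k)" by simp
    from close[OF this] show "\<exists>x. x \<in> (\<Pi>\<^sub>E n\<in>UNIV. Y n) \<and>
      (\<forall>\<^sub>F n in U. nrm n (inv\<^bsub>G n\<^esub> x n \<otimes>\<^bsub>G n\<^esub> g n) < ennreal (1 / real (Suc k)))"
      unfolding cls_mem_set_mult_ball_iff[OF Y g] using eventually_less_if_Lim_less by blast
  qed
  from choice[OF this] obtain x where x: "\<And>k. x k \<in> (\<Pi>\<^sub>E n\<in>UNIV. Y n)"
    and ev: "\<And>k. \<forall>\<^sub>F n in U. nrm n (inv\<^bsub>G n\<^esub> x k n \<otimes>\<^bsub>G n\<^esub> g n) < ennreal (1 / real (Suc k))"
    by blast
  obtain K where K: "\<And>k. \<forall>\<^sub>F n in U. k \<le> K n \<and>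
      nrm n (inv\<^bsub>G n\<^esub> x (K n) n \<otimes>\<^bsub>G n\<^esub> g n) < ennreal (1 / real (Suc (K n)))"
    using diagonal_index[of "\<lambda>k n. nrm n (inv\<^bsub>G n\<^esub> x k n \<otimes>\<^bsub>G n\<^esub> g n) < ennreal (1 / real (Suc k))", OF ev]
    by blast
  have "((\<lambda>n. nrm n (inv\<^bsub>G n\<^esub> x (K n) n \<otimes>\<^bsub>G n\<^esub> g n)) \<longlongrightarrow> 0) U"
  proof (rule order_tendstoI)
    fix a :: ennreal assume "0 < a"
    then obtain k where k: "ennreal (1 / real (Suc k)) < a"
    proof -
      \<comment> \<open>The bound \<open>a\<close> may be infinite, so a positive real below it is
        chosen before the Archimedean property is applied.\<close>
      obtain r where r: "0 < r" "ennreal r \<le> a"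
      proof (cases a)
        case (real r)
        then show ?thesis using that \<open>0 < a\<close> by (auto simp: ennreal_zero_less_one)
      next
        case top
        then show ?thesis using that[of 1] by simp
      qed
      obtain k where "1 / real (Suc k) < r"
        using nat_approx_posE[OF r(1)] by blast
      then have "ennreal (1 / real (Suc k)) < ennreal r"
        using r(1) by (intro ennreal_lessI)
      then show ?thesis using that r(2) by (meson less_le_trans)
    qed
    show "\<forall>\<^sub>F n in U. nrm n (inv\<^bsub>G n\<^esub> x (K n) n \<otimes>\<^bsub>G n\<^esub> g n) < a"
      using K[of k]
    proof eventually_elim
      case (elim n)
      then have "ennreal (1 / real (Suc (K n))) \<le> ennreal (1 / real (Suc k))"
        by (intro ennreal_leI frac_le) auto
      with elim k show ?case by (meson less_le_trans less_trans)
    qed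
  qed auto
  \<comment> \<open>Mixing components of different \<open>x k\<close> stays inside the set because
    it is a full product.\<close>
  moreover have "(\<lambda>n. x (K n) n) \<in> (\<Pi>\<^sub>E n\<in>UNIV. Y n)"
    using x by (auto simp: PiE_iff)
  ultimately show ?thesis
    unfolding cls_mem_internal_set_iff[OF Y g] by (rule bexI)
qed

section \<open>Covers of the ultraproduct and of its components\<close>

context
  fixes X :: "nat \<Rightarrow> nat \<Rightarrow> 'a set"
  assumes X: "\<And>m n. X m n \<subseteq> carrier (G n)"
begin

text \<open>This is the open \<epsilon>-neighbourhood of the internal set given by
  \<open>X m\<close>.\<close>

abbreviation "thickening m \<epsilon> \<equiv>
  internal_set U G nrm (X m) <#>\<^bsub>Gmet\<^esub> ball_one Gmet (ultraproduct_norm U nrm) \<epsilon>"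

lemma cover_iff:
  "carrier Gmet = (\<Union>m\<le>N. thickening m (\<epsilon> m)) \<longleftrightarrow>
    (\<forall>g\<in>carrier P. \<exists>m\<in>{..N}. cls g \<in> thickening m (\<epsilon> m))"
  by (rule carrier_metric_ultraproduct_eq_Union_iff) (rule set_mult_ball_subset_carrier[OF X])

lemma finite_subcover_if_cover:
  assumes cover: "carrier Gmet = (\<Union>m. internal_set U G nrm (X m))"
    and \<epsilon>: "\<And>m. 0 < \<epsilon> m"
  shows "\<exists>N. carrier Gmet = (\<Union>m\<le>N. thickening m (\<epsilon> m))"
proof (rule ccontr)
  assume "\<not> ?thesis"
  then have "\<exists>g. g \<in> carrier P \<and> (\<forall>m\<in>{..N}. cls g \<notin> thickening m (\<epsilon> m))" for N
    unfolding cover_iff by blast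
  then obtain h where h: "\<And>N. h N \<in> carrier P"
    and notin: "\<And>N m. m \<le> N \<Longrightarrow> cls (h N) \<notin> thickening m (\<epsilon> m)"
    by (metis atMost_iff)
  \<comment> \<open>If some component of \<open>X m\<close> is empty, then so is the whole internal set, and \<open>g\<close> avoids it trivially.\<close>
  define far where "far N n \<longleftrightarrow> (\<forall>m\<le>N. (\<forall>n. X m n \<noteq> {}) \<longrightarrow>
      (\<forall>x\<in>X m n. ennreal (\<epsilon> m / 2) < nrm n (inv\<^bsub>G n\<^esub> x \<otimes>\<^bsub>G n\<^esub> h N n)))" for N n
  have "\<forall>\<^sub>F n in U. far N n" for N
  proof -
    have "\<forall>\<^sub>F n in U. \<forall>m\<in>{..N}. (\<forall>n. X m n \<noteq> {}) \<longrightarrow>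
        (\<forall>x\<in>X m n. ennreal (\<epsilon> m / 2) < nrm n (inv\<^bsub>G n\<^esub> x \<otimes>\<^bsub>G n\<^esub> h N n))"
    proof (intro eventually_ball_finite ballI finite_atMost)
      fix m assume "m \<in> {..N}"
      then show "\<forall>\<^sub>F n in U. (\<forall>n. X m n \<noteq> {}) \<longrightarrow>
        (\<forall>x\<in>X m n. ennreal (\<epsilon> m / 2) < nrm n (inv\<^bsub>G n\<^esub> x \<otimes>\<^bsub>G n\<^esub> h N n))"
        using cls_notin_set_mult_ball[OF X _ h notin \<epsilon>, of m N "\<epsilon> m / 2"] \<epsilon>[of m]
        by (cases "\<forall>n. X m n \<noteq> {}") auto
    qed
    then show ?thesis by (simp add: far_def Ball_def)
  qed
  then obtain K where K: "\<And>k. \<forall>\<^sub>F n in U. k \<le> K n \<and> far (K n) n"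
    using diagonal_index[of far] by blast
  define g where "g = (\<lambda>n. h (K n) n)"
  have g: "g \<in> carrier P" using h by (auto simp: g_def PiE_iff)
  then obtain m where "cls g \<in> internal_set U G nrm (X m)"
    using cover unfolding carrier_metric_ultraproduct by blast
  then obtain x where x: "x \<in> (\<Pi>\<^sub>E n\<in>UNIV. X m n)"
    and lim: "((\<lambda>n. nrm n (inv\<^bsub>G n\<^esub> x n \<otimes>\<^bsub>G n\<^esub> g n)) \<longlongrightarrow> 0) U"
    unfolding cls_mem_internal_set_iff[OF X g] by blast
  have "0 < ennreal (\<epsilon> m / 2)" using \<epsilon>[of m] by simp
  then have "\<forall>\<^sub>F n in U. nrm n (inv\<^bsub>G n\<^esub> x n \<otimes>\<^bsub>G n\<^esub> g n) < ennreal (\<epsilon> m / 2)"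
    by (rule order_tendstoD(2)[OF lim])
  \<comment> \<open>Almost everywhere \<open>m \<le> K n\<close>, so \<open>far (K n) n\<close>
    speaks about the index \<open>m\<close>. The existence of \<open>x\<close> shows that no
    component of \<open>X m\<close> is empty, as the guard in \<open>far\<close> demands.\<close>
  with K[of m] have "\<forall>\<^sub>F n in U. False"
  proof eventually_elim
    case (elim n)
    have "\<forall>n. X m n \<noteq> {}" "x n \<in> X m n" using x by (auto simp: PiE_iff)
    then have "ennreal (\<epsilon> m / 2) < nrm n (inv\<^bsub>G n\<^esub> x n \<otimes>\<^bsub>G n\<^esub> g n)"
      using elim unfolding far_def g_def by blast
    then show ?case using elim by (meson less_asym)
  qed
  then show False using U_nontrivial by (simp add: trivial_limit_def)
qed

lemma cover_if_finite_subcovers: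
  assumes "\<And>\<epsilon>. (\<And>m. 0 < \<epsilon> m) \<Longrightarrow> \<exists>N::nat. carrier Gmet = (\<Union>m\<le>N. thickening m (\<epsilon> m))"
  shows "carrier Gmet = (\<Union>m. internal_set U G nrm (X m))"
proof (rule ccontr)
  assume "\<not> ?thesis"
  then obtain g where g: "g \<in> carrier P" and "\<And>m. cls g \<notin> internal_set U G nrm (X m)"
    unfolding carrier_metric_ultraproduct_eq_Union_iff[OF internal_set_subset_carrier[OF X]]
    by blast
  then have "\<exists>\<epsilon>. 0 < \<epsilon> \<and> cls g \<notin> thickening m \<epsilon>" for m
    using internal_set_closed[of "X m", OF X g] by blast
  then have "\<forall>m. \<exists>\<epsilon>. 0 < \<epsilon> \<and> cls g \<notin> thickening m \<epsilon>"
    by (rule allI)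
  from choice[OF this] obtain \<epsilon>
    where "\<forall>m. 0 < \<epsilon> m \<and> cls g \<notin> thickening m (\<epsilon> m)" ..
  then have \<epsilon>: "\<And>m. 0 < \<epsilon> m" and notin: "\<And>m. cls g \<notin> thickening m (\<epsilon> m)"
    by blast+
  \<comment> \<open>The same point \<open>g\<close> is missed at every index \<open>m\<close>, so it
    refutes the cover whatever \<open>N\<close> is.\<close>
  from assms[OF \<epsilon>] obtain N where "carrier Gmet = (\<Union>m\<le>N. thickening m (\<epsilon> m))" ..
  with notin g show False
    unfolding carrier_metric_ultraproduct by blast
qed

lemma componentwise_cover_iff:
  "carrier (G n) = (\<Union>m\<le>N. X m n <#>\<^bsub>G n\<^esub> ball_one (G n) (nrm n) (\<epsilon> m)) \<longleftrightarrow>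
    (\<forall>g\<in>carrier (G n). \<exists>m\<le>N. \<exists>x\<in>X m n. nrm n (inv\<^bsub>G n\<^esub> x \<otimes>\<^bsub>G n\<^esub> g) < ennreal (\<epsilon> m))"
proof -
  have "X m n <#>\<^bsub>G n\<^esub> ball_one (G n) (nrm n) (\<epsilon> m) \<subseteq> carrier (G n)" for m
    using X by (intro comp.setmult_subset_G) (auto simp: ball_one_def)
  then have "carrier (G n) = (\<Union>m\<le>N. X m n <#>\<^bsub>G n\<^esub> ball_one (G n) (nrm n) (\<epsilon> m)) \<longleftrightarrow>
      (\<forall>g\<in>carrier (G n). \<exists>m\<le>N. g \<in> X m n <#>\<^bsub>G n\<^esub> ball_one (G n) (nrm n) (\<epsilon> m))"
    by blast
  then show ?thesis
    using comp.mem_set_mult_ball_one_iff[OF X] by simp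
qed

text \<open>Uncovered points of the components form one element \<open>g\<close>. Its class lies in
  some neighbourhood, and a limit strictly below a radius keeps almost all distances below that same
  radius, so the radii need no change here.\<close>

lemma componentwise_cover_if_cover:
  assumes "carrier Gmet = (\<Union>m\<le>N. thickening m (\<epsilon> m))"
  shows "\<forall>\<^sub>F n in U. carrier (G n) = (\<Union>m\<le>N. X m n <#>\<^bsub>G n\<^esub> ball_one (G n) (nrm n) (\<epsilon> m))"
proof (rule ccontr)
  let ?good = "\<lambda>n g. \<exists>m\<le>N. \<exists>x\<in>X m n. nrm n (inv\<^bsub>G n\<^esub> x \<otimes>\<^bsub>G n\<^esub> g) < ennreal (\<epsilon> m)"
  assume "\<not> ?thesis"
  then have ev: "\<forall>\<^sub>F n in U. \<exists>g\<in>carrier (G n). \<not> ?good n g"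
    unfolding componentwise_cover_iff not_eventually_iff by (rule eventually_mono) blast
  \<comment> \<open>Where the component is covered, the unit can serve as the value of
    \<open>g\<close>.\<close>
  have "\<exists>g. g \<in> carrier (G n) \<and> ((\<exists>g\<in>carrier (G n). \<not> ?good n g) \<longrightarrow> \<not> ?good n g)" for n
    using comp.one_closed[of n] by blast
  then obtain g where gn: "\<And>n. g n \<in> carrier (G n)"
    and bad: "\<And>n. \<exists>g\<in>carrier (G n). \<not> ?good n g \<Longrightarrow> \<not> ?good n (g n)"
    by metis
  have g: "g \<in> carrier P" using gn by (simp add: PiE_iff)
  then obtain m where m: "m \<le> N" "cls g \<in> thickening m (\<epsilon> m)"
    using assms unfolding carrier_metric_ultraproduct by blast
  then obtain x where x: "x \<in> (\<Pi>\<^sub>E n\<in>UNIV. X m n)"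
    and "Lim U (\<lambda>n. nrm n (inv\<^bsub>G n\<^esub> x n \<otimes>\<^bsub>G n\<^esub> g n)) < ennreal (\<epsilon> m)"
    unfolding cls_mem_set_mult_ball_iff[OF X g] by blast
  then have "\<forall>\<^sub>F n in U. nrm n (inv\<^bsub>G n\<^esub> x n \<otimes>\<^bsub>G n\<^esub> g n) < ennreal (\<epsilon> m)"
    by (intro eventually_less_if_Lim_less)
  with ev have "\<forall>\<^sub>F n in U. False"
  proof eventually_elim
    case (elim n)
    have "x n \<in> X m n" using x by (auto simp: PiE_iff)
    then show ?case using bad[OF elim(1)] elim(2) m(1) by blast
  qed
  then show False using U_nontrivial by (simp add: trivial_limit_def)
qed

text \<open>Distances below \<open>\<epsilon> m / 2\<close> only have a limit of at most
  \<open>\<epsilon> m / 2\<close>, hence the smaller radii in the components. A single empty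
  component empties the internal set while other components of \<open>X m\<close> could still help
  to cover; \<open>ne\<close> makes such an \<open>X m\<close> empty almost everywhere.\<close>

lemma cover_if_componentwise_cover:
  assumes ne: "\<And>m n. X m n = {} \<Longrightarrow> \<forall>\<^sub>F n in U. X m n = {}"
    and \<epsilon>: "\<And>m. 0 < \<epsilon> m"
    and cover: "\<forall>\<^sub>F n in U. carrier (G n) = (\<Union>m\<le>N. X m n <#>\<^bsub>G n\<^esub> ball_one (G n) (nrm n) (\<epsilon> m / 2))"
  shows "carrier Gmet = (\<Union>m\<le>N. thickening m (\<epsilon> m))"
proof -
  have "\<exists>m\<in>{..N}. cls g \<in> thickening m (\<epsilon> m)" if g: "g \<in> carrier P" for g
  proof (rule ccontr)
    assume "\<not> ?thesis"
    then have notin: "cls g \<notin> thickening m (\<epsilon> m)" if "m \<le> N" for m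
      using that by blast
    have "\<forall>\<^sub>F n in U. \<forall>x\<in>X m n. ennreal (\<epsilon> m / 2) < nrm n (inv\<^bsub>G n\<^esub> x \<otimes>\<^bsub>G n\<^esub> g n)"
      if m: "m \<le> N" for m
    proof (cases "\<forall>n. X m n \<noteq> {}")
      case True
      then show ?thesis
        using cls_notin_set_mult_ball[OF X _ g notin[OF m] \<epsilon>] \<epsilon>[of m] by simp
    next
      case False
      then have "\<forall>\<^sub>F n in U. X m n = {}" using ne by blast
      then show ?thesis by eventually_elim simp
    qed
    then have "\<forall>\<^sub>F n in U. \<forall>m\<in>{..N}. \<forall>x\<in>X m n. ennreal (\<epsilon> m / 2) < nrm n (inv\<^bsub>G n\<^esub> x \<otimes>\<^bsub>G n\<^esub> g n)"
      by (intro eventually_ball_finite) auto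
    with cover have "\<forall>\<^sub>F n in U. False"
    proof eventually_elim
      case (elim n)
      have "g n \<in> carrier (G n)" using g by auto
      then show ?case using elim unfolding componentwise_cover_iff
        by (meson atMost_iff less_asym)
    qed
    then show False using U_nontrivial by (simp add: trivial_limit_def)
  qed
  then show ?thesis
    unfolding cover_iff by blast
qed

end

section \<open>Uniformly bounded norms\<close>

lemma finitary_part_eq_carrier:
  assumes "(SUP n. SUP g\<in>carrier (G n). nrm n g) < \<infinity>"
  shows "finitary_part U G nrm = carrier Gmet"
proof -
  have "ultraproduct_norm U nrm (cls g) < \<infinity>" if g: "g \<in> carrier P" for g
  proof -
    have "nrm n (g n) \<le> (SUP n. SUP g\<in>carrier (G n). nrm n g)" for n
      using g by (intro SUP_upper2[of n] SUP_upper) auto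
    then have "Lim U (\<lambda>n. nrm n (g n)) \<le> (SUP n. SUP g\<in>carrier (G n). nrm n g)"
      by (intro Lim_le always_eventually allI)
    then show ?thesis
      unfolding ultraproduct_norm_cls[OF g] using assms by (rule le_less_trans)
  qed
  then show ?thesis
    unfolding finitary_part_def carrier_metric_ultraproduct by blast
qed

end

theorem theorem2p7:
  fixes G :: "nat \<Rightarrow> ('a, 'b) monoid_scheme"
    and nrm :: "nat \<Rightarrow> 'a \<Rightarrow> ennreal"
    and U :: "nat filter"
    and X :: "nat \<Rightarrow> nat \<Rightarrow> 'a set"
  assumes "\<And>n. metric_group (G n) (nrm n)"
    and "(SUP n. SUP g\<in>carrier (G n). nrm n g) < \<infinity>"
    and "nonprincipal_ultrafilter U"
    and "\<And>m n. X m n \<subseteq> carrier (G n)"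
  defines "Gmet \<equiv> metric_ultraproduct U G nrm"
    and "XX \<equiv> (\<lambda>m. internal_set U G nrm (X m))"
  defines "cond1 \<equiv> carrier Gmet = (\<Union>m. XX m)"
    and "cond2 \<equiv> (\<forall>\<epsilon> :: nat \<Rightarrow> real. (\<forall>m. 0 < \<epsilon> m) \<longrightarrow>
      (\<exists>N. carrier Gmet =
        (\<Union>m\<le>N. XX m <#>\<^bsub>Gmet\<^esub> ball_one Gmet (ultraproduct_norm U nrm) (\<epsilon> m))))"
    and "cond2' \<equiv> (\<forall>\<epsilon> :: nat \<Rightarrow> real. (\<forall>m. 0 < \<epsilon> m) \<longrightarrow>
      (\<exists>N. \<forall>\<^sub>F n in U. carrier (G n) =
        (\<Union>m\<le>N. X m n <#>\<^bsub>G n\<^esub> ball_one (G n) (nrm n) (\<epsilon> m))))"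
  shows "finitary_part U G nrm = carrier Gmet \<and>
    (cond1 \<longleftrightarrow> cond2) \<and>
    (cond2 \<longrightarrow> cond2') \<and>
    ((\<forall>m. (\<exists>n. X m n = {}) \<longrightarrow> (\<forall>\<^sub>F n in U. X m n = {})) \<longrightarrow> cond2' \<longrightarrow> cond2)"
proof -
  interpret metric_group_sequence G nrm U
    using assms(1,3) by (rule metric_group_sequence.intro)
  note X = assms(4)
  note defs = Gmet_def XX_def cond1_def cond2_def cond2'_def
  have "cond1 \<longleftrightarrow> cond2"
  proof
    show cond2 if cond1
      using that unfolding defs by (intro allI impI finite_subcover_if_cover[OF X]) simp_all
    show cond1 if cond2
      using that unfolding defs by (intro cover_if_finite_subcovers[OF X]) simp
  qed
  moreover have "cond2 \<longrightarrow> cond2'"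
    unfolding defs using componentwise_cover_if_cover[OF X] by meson
  moreover have cond2
    if ne: "\<forall>m. (\<exists>n. X m n = {}) \<longrightarrow> (\<forall>\<^sub>F n in U. X m n = {})" and cond2'
    unfolding defs
  proof (intro allI impI)
    fix \<epsilon> :: "nat \<Rightarrow> real" assume \<epsilon>: "\<forall>m. 0 < \<epsilon> m"
    \<comment> \<open>The componentwise condition is applied to the halved sequence, which absorbs
      the loss of strictness in the limit.\<close>
    then have "\<forall>m. 0 < \<epsilon> m / 2" by simp
    then obtain N where cover:
      "\<forall>\<^sub>F n in U. carrier (G n) = (\<Union>m\<le>N. X m n <#>\<^bsub>G n\<^esub> ball_one (G n) (nrm n) (\<epsilon> m / 2))"
      using \<open>cond2'\<close> unfolding cond2'_def by (elim allE[of _ "\<lambda>m. \<epsilon> m / 2"] impE exE)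
    show "\<exists>N. carrier (metric_ultraproduct U G nrm) =
        (\<Union>m\<le>N. internal_set U G nrm (X m) <#>\<^bsub>metric_ultraproduct U G nrm\<^esub>
          ball_one (metric_ultraproduct U G nrm) (ultraproduct_norm U nrm) (\<epsilon> m))"
      by (rule exI, rule cover_if_componentwise_cover[OF X _ _ cover]) (use ne \<epsilon> in blast)+
  qed
  ultimately show ?thesis
    unfolding Gmet_def using finitary_part_eq_carrier[OF assms(2)] by blast
qed

end
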